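(* For every integer $n\geqslant 2$, $$b_n(x,y)=(1+y)\sum_{k\geqslant 0}4^k\xi(n,k)(xy)^k(1+xy)^{n-1-2k}+y(1+x)\sum_{k\geqslant 0}4^k\zeta(n,k)(xy)^{k}(1+xy)^{n-2-2k},$$ where $\xi(n,k)=T(n,2k+1)$ and $\zeta(n,k)=2T(n,2k+2)$.
   Context: $\mathfrak{S}_n^B$ is the hyperoctahedral group of signed permutations $\pi=\pi(1)\cdots\pi(n)$ of $\pm[n]$ (with $\pi(-i)=-\pi(i)$). For $\pi\in\mathfrak{S}_n^B$: $\operatorname{des}_A(\pi)=\#\{i\in\{1,\ldots,n-1\}:\pi(i)>\pi(i+1)\}$ and $\operatorname{des}_B(\pi)=\#\{i\in\{0,1,\ldots,n-1\}:\pi(i)>\pi(i+1)\}$ with the convention $\pi(0)=0$. Set $b_n(x,y)=\sum_{\pi\in\mathfrak{S}_n^B}x^{\operatorname{des}_A(\pi)}y^{\operatorname{des}_B(\pi)}$. For an ordinary permutation $\pi\in\mathfrak{S}_n$, the number of up-down runs $\mathrm{udrun}(\pi)$ is the number of maximal contiguous monotone (increasing or decreasing) runs of the word $0\pi(1)\pi(2)\cdots\pi(n)$; equivalently, with $\pi(0)=0$, $\mathrm{udrun}(\pi)=1+\#\{i\in[n-1]:(\pi(i)-\pi(i-1))(\pi(i+1)-\pi(i))<0\}$ (e.g. $\mathrm{udrun}(623415)=5$). $T(n,k)$ is the number of $\pi\in\mathfrak{S}_n$ with $\mathrm{udrun}(\pi)=k$. *)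

theory Defs
  imports
    Main
    "HOL-Library.Groups_Big_Fun"
    "HOL-Combinatorics.Permutations"
begin

(* A permutation of a set is the identity outside it (permutes), so the conventions
   p 0 = 0 for signed and for ordinary permutations hold automatically. *)

definition pm :: "nat \<Rightarrow> int set" where
  "pm n = {- int n..int n} - {0}"

definition signed_perms :: "nat \<Rightarrow> (int \<Rightarrow> int) set" where
  "signed_perms n = {p. p permutes pm n \<and> (\<forall>i\<in>pm n. p (- i) = - p i)}"

definition desA :: "nat \<Rightarrow> (int \<Rightarrow> int) \<Rightarrow> nat" where
  "desA n p = card {i \<in> {1..int n - 1}. p i > p (i + 1)}"

definition desB :: "nat \<Rightarrow> (int \<Rightarrow> int) \<Rightarrow> nat" where
  "desB n p = card {i \<in> {0..int n - 1}. p i > p (i + 1)}"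

definition b_poly :: "nat \<Rightarrow> 'a::comm_ring_1 \<Rightarrow> 'a \<Rightarrow> 'a" where
  "b_poly n x y = (\<Sum>p\<in>signed_perms n. x ^ desA n p * y ^ desB n p)"

definition monotone_factor :: "(nat \<Rightarrow> nat) \<Rightarrow> nat \<Rightarrow> nat \<Rightarrow> bool" where
  "monotone_factor p a b \<longleftrightarrow>
     strict_mono_on {a..b} p \<or> strict_antimono_on {a..b} p"

(* A run of the word p 0, p 1, ..., p n is represented by its first and last position. *)
definition runs :: "nat \<Rightarrow> (nat \<Rightarrow> nat) \<Rightarrow> (nat \<times> nat) set" where
  "runs n p = {(a, b). a \<le> b \<and> b \<le> n \<and> monotone_factor p a b \<and>
     (\<forall>c d. c \<le> a \<and> b \<le> d \<and> d \<le> n \<and> monotone_factor p c d \<longrightarrow> c = a \<and> d = b)}"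

definition udrun :: "nat \<Rightarrow> (nat \<Rightarrow> nat) \<Rightarrow> nat" where
  "udrun n p = card (runs n p)"

definition T :: "nat \<Rightarrow> nat \<Rightarrow> nat" where
  "T n k = card {p. p permutes {1..n} \<and> udrun n p = k}"

definition xi :: "nat \<Rightarrow> nat \<Rightarrow> nat" where
  "xi n k = T n (2 * k + 1)"

definition zeta :: "nat \<Rightarrow> nat \<Rightarrow> nat" where
  "zeta n k = 2 * T n (2 * k + 2)"

lemma monotone_factor_iff:
  assumes inj: "inj_on p {0..n}" and bn: "b \<le> n"
  shows "monotone_factor p a b \<longleftrightarrow>
    (\<forall>i\<in>{a..<b}. (p i < p (Suc i)) = (p a < p (Suc a)))" (is "?L \<longleftrightarrow> ?R")
proof
  assume ?L
  then show ?R
    unfolding monotone_factor_def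
  proof
    assume m: "strict_mono_on {a..b} p"
    have "p i < p (Suc i)" if "a \<le> i" "i < b" for i
      using monotone_onD[OF m, of i "Suc i"] that by auto
    then show ?R by auto
  next
    assume m: "strict_antimono_on {a..b} p"
    have "\<not> p i < p (Suc i)" if "a \<le> i" "i < b" for i
      using monotone_onD[OF m, of i "Suc i"] that by auto
    then show ?R by auto
  qed
next
  assume R: ?R
  show ?L
  proof (cases "p a < p (Suc a)")
    case True
    have "p i < p j" if "i < j" "a \<le> i" "j \<le> b" for i j
      using that
    proof (induction rule: less_Suc_induct)
      case (1 i)
      with R True show ?case by auto
    next
      case (2 i j k)
      then show ?case by (meson le_trans less_imp_le less_trans)
    qed
    then show ?thesis unfolding monotone_factor_def by (auto intro!: monotone_onI)
  next
    case False
    have "p i > p j" if "i < j" "a \<le> i" "j \<le> b" for i j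
      using that
    proof (induction rule: less_Suc_induct)
      case (1 i)
      then have "\<not> p i < p (Suc i)" using R False by auto
      moreover have "p i \<noteq> p (Suc i)"
        using 1 bn inj_onD[OF inj, of i "Suc i"] by auto
      ultimately show ?case by simp
    next
      case (2 i j k)
      then show ?case by (meson le_trans less_imp_le less_trans)
    qed
    then show ?thesis unfolding monotone_factor_def by (auto intro!: monotone_onI)
  qed
qed

lemma card_runs:
  assumes inj: "inj_on p {0..n}"
  shows "card (runs n p) =
    card (insert 0 {a. 0 < a \<and> a < n \<and> (p (a - 1) < p a) \<noteq> (p a < p (a + 1))})"
    (is "_ = card ?S")
proof -
  define u where "u i \<longleftrightarrow> p i < p (Suc i)" for i
  define C where "C a b \<longleftrightarrow> (\<forall>i\<in>{a..<b}. u i = u a)" for a b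
  have mC: "monotone_factor p a b \<longleftrightarrow> C a b" if "b \<le> n" for a b
    using monotone_factor_iff[OF inj that] by (simp add: C_def u_def)
  have runsD: "c = a \<and> d = b"
    if "(a, b) \<in> runs n p" "c \<le> a" "b \<le> d" "d \<le> n" "C c d" for a b c d
    using that mC[of d c] unfolding runs_def by blast
  have runsC: "a \<le> b" "b \<le> n" "C a b" if "(a, b) \<in> runs n p" for a b
    using that mC[of b a] unfolding runs_def by blast+
  have S: "?S = insert 0 {a. 0 < a \<and> a < n \<and> u (a - 1) \<noteq> u a}"
    by (auto simp: u_def)
  have "bij_betw fst (runs n p) ?S"
    unfolding bij_betw_def
  proof
    show "inj_on fst (runs n p)"
    proof (rule inj_onI, clarsimp)
      fix a b b' assume 1: "(a, b) \<in> runs n p" and 2: "(a, b') \<in> runs n p"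
      show "b = b'"
      proof (cases "b \<le> b'")
        case True
        then show ?thesis using runsD[OF 1, of a b'] runsC[OF 2] by simp
      next
        case False
        then show ?thesis using runsD[OF 2, of a b] runsC[OF 1] by simp
      qed
    qed
    show "fst ` runs n p = ?S"
    proof
      show "fst ` runs n p \<subseteq> ?S"
        unfolding S
      proof clarsimp
        fix a b assume r: "(a, b) \<in> runs n p" and a: "0 < a"
        have not: "\<not> C (a - 1) b"
          using runsD[OF r, of "a - 1" b] runsC[OF r] a by auto
        have "a < b"
        proof (rule ccontr)
          assume "\<not> a < b"
          with runsC[OF r] have "b = a" by simp
          then have "{a - 1..<b} = {a - 1}" using a by auto
          then have "C (a - 1) b" unfolding C_def by simp
          with not show False ..
        qed
        moreover have "u (a - 1) \<noteq> u a"
        proof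
          assume eq: "u (a - 1) = u a"
          have "C (a - 1) b" unfolding C_def
          proof
            fix i assume "i \<in> {a - 1..<b}"
            then have "i = a - 1 \<or> i \<in> {a..<b}" by auto
            then show "u i = u (a - 1)"
              using runsC(3)[OF r] eq unfolding C_def by blast
          qed
          with not show False by simp
        qed
        ultimately show "a < n \<and> u (a - Suc 0) = (\<not> u a)"
          using runsC[OF r] by auto
      qed
      show "?S \<subseteq> fst ` runs n p"
      proof
        fix a assume "a \<in> ?S"
        then have a: "a = 0 \<or> 0 < a \<and> a < n \<and> u (a - 1) \<noteq> u a" unfolding S by auto
        define B where "B = {b. a \<le> b \<and> b \<le> n \<and> C a b}"
        define b where "b = Max B"
        have fin: "finite B" unfolding B_def by (rule finite_subset[of _ "{..n}"]) auto
        have "a \<in> B" using a by (auto simp: B_def C_def)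
        then have "b \<in> B" unfolding b_def using fin Max_in by blast
        then have b: "a \<le> b" "b \<le> n" "C a b" by (auto simp: B_def)
        have bmax: "d \<le> b" if "a \<le> d" "d \<le> n" "C a d" for d
          using that fin unfolding b_def by (auto simp: B_def)
        have "c = a \<and> d = b" if "c \<le> a" "b \<le> d" "d \<le> n" "C c d" for c d
        proof -
          have "c = a"
          proof (rule ccontr)
            assume "c \<noteq> a"
            with that have ca: "c < a" by simp
            with a have a': "0 < a" "a < n" "u (a - 1) \<noteq> u a" by auto
            have "Suc a \<le> b" using a' by (intro bmax) (auto simp: C_def less_Suc_eq)
            with that have "a < d" by simp
            then have "a \<in> {c..<d}" "a - 1 \<in> {c..<d}" using ca by auto
            then have "u a = u c" "u (a - 1) = u c"
              using that(4) unfolding C_def by blast+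
            with a' show False by simp
          qed
          moreover from this have "d = b" using bmax[of d] that b by simp
          ultimately show ?thesis by blast
        qed
        then have "(a, b) \<in> runs n p"
          using b mC unfolding runs_def by auto
        then show "a \<in> fst ` runs n p" by force
      qed
    qed
  qed
  then show ?thesis by (rule bij_betw_same_card)
qed

lemma inj_on_perm: "p permutes A \<Longrightarrow> inj_on p B"
  by (meson permutes_inj inj_on_subset subset_UNIV)

theorem udrun_eq:
  assumes p: "p permutes {1..n}"
  shows "udrun n p = 1 + card {i \<in> {1..n - 1}.
    (int (p i) - int (p (i - 1))) * (int (p (i + 1)) - int (p i)) < 0}"
proof -
  have "{a. 0 < a \<and> a < n \<and> (p (a - 1) < p a) \<noteq> (p a < p (a + 1))} =
      {i \<in> {1..n - 1}. (int (p i) - int (p (i - 1))) * (int (p (i + 1)) - int (p i)) < 0}"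
    (is "?A = ?B")
  proof -
    have "a \<in> ?A \<longleftrightarrow> a \<in> ?B" for a
    proof (cases "0 < a \<and> a < n")
      case True
      have ne: "p (a - 1) \<noteq> p a" "p (a + 1) \<noteq> p a"
        using True by (auto simp: inj_eq[OF permutes_inj[OF p]])
      show ?thesis using True ne
        by (auto simp: mult_less_0_iff)
    qed auto
    then show ?thesis by blast
  qed
  moreover have "finite ?A" by simp
  ultimately show ?thesis
    unfolding udrun_def card_runs[OF inj_on_perm[OF p]] by simp
qed

(* Hence sums over all k of multiples of xi n k or zeta n k have finite support, and every
   term whose exponent n - 1 - 2k or n - 2 - 2k would be truncated at 0 has coefficient 0. *)
lemma T_eq_0:
  assumes "n \<ge> 1" "k > n"
  shows "T n k = 0"
proof -
  have "udrun n p \<le> n" if p: "p permutes {1..n}" for p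
  proof -
    have "card {i \<in> {1..n - 1}.
        (int (p i) - int (p (i - 1))) * (int (p (i + 1)) - int (p i)) < 0} \<le> card {1..n - 1}"
      by (rule card_mono) auto
    then show ?thesis using udrun_eq[OF p] assms(1) by simp
  qed
  then have "{p. p permutes {1..n} \<and> udrun n p = k} = {}" using assms(2) by force
  then show ?thesis unfolding T_def by (simp only: card.empty)
qed

end

theory Submission
  imports Defs
begin

text \<open>Write a signed permutation as a permutation \<open>p\<close> of \<open>{1..n}\<close> together with the set \<open>S\<close> of positions
  carrying a minus sign, and extend \<open>p\<close> by \<open>p 0 = 0\<close> and \<open>p (n + 1) = n + 1\<close>. For fixed \<open>p\<close> the
  sum over \<open>S\<close> factorizes over the positions: a peak at \<open>j > 1\<close> contributes \<open>2xy\<close>, a valley \<open>2\<close>, any other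
  \<open>j > 1\<close> contributes \<open>1 + xy\<close>, and position \<open>1\<close> contributes \<open>1 + y\<close> or \<open>y (1 + x)\<close> according to
  whether \<open>p 1 < p 2\<close>. As the extended word starts and ends with a rise, it has as many peaks as valleys, so
  this weight depends only on the number of turns and on whether \<open>p 1 < p 2\<close>. Reversing and
  complementing preserves the number of turns and exchanges the conditions \<open>p 1 < p 2\<close> and
  \<open>p (n - 1) < p n\<close>; the latter together with the number of turns determines \<open>udrun\<close>, and
  holds exactly if \<open>udrun\<close> is odd.\<close>

section \<open>Rises, turns, and products over positions\<close>

definition rise :: "(nat \<Rightarrow> nat) \<Rightarrow> nat \<Rightarrow> bool" where
  "rise p i \<longleftrightarrow> p i < p (Suc i)"

text \<open>A permutation of \<open>{1..n}\<close> fixes \<open>0\<close> and \<open>Suc n\<close>,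
  so \<open>p\<close> itself is the extended word and the last position \<open>n\<close> can be a
  turn as well.\<close>

definition turns :: "nat \<Rightarrow> (nat \<Rightarrow> nat) \<Rightarrow> nat set" where
  "turns n p = {i \<in> {1..n}. rise p (i - 1) \<noteq> rise p i}"

text \<open>Each peak switches \<open>u\<close> from true to false and each valley switches it back,
  so the counts telescope to the change from \<open>u a\<close> to \<open>u b\<close>.\<close>

lemma peaks_valleys_balance:
  fixes u :: "nat \<Rightarrow> bool"
  assumes "a \<le> b"
  shows "card {j \<in> {a<..b}. u (j - 1) \<and> \<not> u j} + of_bool (u b)
    = card {j \<in> {a<..b}. \<not> u (j - 1) \<and> u j} + of_bool (u a)"
  using assms
proof (induction b rule: dec_induct)
  case base
  then show ?case by simp
next
  case (step b)
  have *: "{j \<in> {a<..Suc b}. Q j} = {j \<in> {a<..b}. Q j} \<union> (if Q (Suc b) then {Suc b} else {})"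
    for Q using step(1) by (auto simp: le_Suc_eq)
  show ?case
    unfolding * using step.IH by (auto simp: card_insert_if split: if_splits)
qed

text \<open>Split \<open>A\<close> into peaks, valleys and the rest, where both arguments of
  \<open>f\<close> agree. As \<open>P\<close> and \<open>V\<close> are disjoint subsets of
  \<open>A\<close>, no subtraction in the last exponent truncates.\<close>

lemma prod_turns:
  fixes f :: "bool \<Rightarrow> bool \<Rightarrow> 'a::comm_monoid_mult" and u :: "nat \<Rightarrow> bool"
  assumes "finite A" and "f True True = c" "f False False = c"
  defines "P \<equiv> {j \<in> A. u (j - 1) \<and> \<not> u j}" and "V \<equiv> {j \<in> A. \<not> u (j - 1) \<and> u j}"
  shows "(\<Prod>j\<in>A. f (u (j - 1)) (u j)) =
    f True False ^ card P * f False True ^ card V * c ^ (card A - card P - card V)"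
proof -
  have fin: "finite P" "finite V" unfolding P_def V_def using assms(1) by auto
  have sub: "P \<subseteq> A" "V \<subseteq> A - P" unfolding P_def V_def by auto
  have "(\<Prod>j\<in>A. f (u (j - 1)) (u j)) =
    (\<Prod>j\<in>A - P - V. f (u (j - 1)) (u j)) * (\<Prod>j\<in>V. f (u (j - 1)) (u j)) * (\<Prod>j\<in>P. f (u (j - 1)) (u j))"
    using sub assms(1) by (simp add: prod.subset_diff[of P A] prod.subset_diff[of V "A - P"])
  also have "(\<Prod>j\<in>P. f (u (j - 1)) (u j)) = f True False ^ card P"
    unfolding P_def by simp
  also have "(\<Prod>j\<in>V. f (u (j - 1)) (u j)) = f False True ^ card V"
    unfolding V_def by simp
  also have "(\<Prod>j\<in>A - P - V. f (u (j - 1)) (u j)) = (\<Prod>j\<in>A - P - V. c)"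
  proof (rule prod.cong[OF refl])
    fix j assume "j \<in> A - P - V"
    then have "u (j - 1) = u j" unfolding P_def V_def by auto
    then show "f (u (j - 1)) (u j) = c" using assms(2,3) by (cases "u j") auto
  qed
  also have "\<dots> = c ^ (card A - card P - card V)"
    using sub fin by (simp add: card_Diff_subset)
  finally show ?thesis by (simp add: mult_ac)
qed

text \<open>Expanding the product on the right, \<open>S\<close> records the factors from which the
  \<open>True\<close> summand is taken.\<close>

lemma sum_Pow_prod:
  fixes g :: "'i \<Rightarrow> bool \<Rightarrow> 'a::comm_semiring_1"
  assumes "finite A"
  shows "(\<Sum>S\<in>Pow A. \<Prod>j\<in>A. g j (j \<in> S)) = (\<Prod>j\<in>A. g j True + g j False)"
proof -
  have "(\<Prod>j\<in>A. g j (j \<in> S)) = (\<Prod>j\<in>S. g j True) * (\<Prod>j\<in>A - S. g j False)"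
    if "S \<in> Pow A" for S
  proof -
    have "(\<Prod>j\<in>A. g j (j \<in> S)) = (\<Prod>j\<in>A - S. g j (j \<in> S)) * (\<Prod>j\<in>S. g j (j \<in> S))"
      using that assms by (intro prod.subset_diff) auto
    then show ?thesis by (simp add: mult.commute)
  qed
  then show ?thesis by (simp add: prod_add[OF assms])
qed

section \<open>Signed permutations as permutations with a set of signs\<close>

text \<open>The factor \<open>sgn i\<close> makes the function odd, with value \<open>0\<close> at
  \<open>0\<close>.\<close>

definition signed :: "(nat \<Rightarrow> nat) \<Rightarrow> nat set \<Rightarrow> int \<Rightarrow> int" where
  "signed p S i = (if nat \<bar>i\<bar> \<in> S then - 1 else 1) * sgn i * int (p (nat \<bar>i\<bar>))"

lemma permutes_atLeastAtMost_simps: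
  fixes n :: nat
  assumes "p permutes {1..n}"
  shows "p 0 = 0" "i > n \<Longrightarrow> p i = i" "p i = 0 \<longleftrightarrow> i = 0"
    "p i = p j \<longleftrightarrow> i = j" "i \<le> n \<Longrightarrow> p i \<le> n"
proof -
  show 0: "p 0 = 0" and "i > n \<Longrightarrow> p i = i"
    using permutes_not_in[OF assms] by auto
  show inj: "p i = p j \<longleftrightarrow> i = j" for i j
    using inj_eq[OF permutes_inj[OF assms]] .
  show "p i = 0 \<longleftrightarrow> i = 0" using inj[of i 0] 0 by simp
  show "p i \<le> n" if "i \<le> n"
    using permutes_in_image[OF assms, of i] 0 that by (cases "i = 0") auto
qed

lemma rise_0:
  assumes "p permutes {1..n}"
  shows "rise p 0"
  using permutes_atLeastAtMost_simps(1)[OF assms] permutes_atLeastAtMost_simps(3)[OF assms, of 1]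
  by (simp add: rise_def)

lemma rise_n:
  assumes "p permutes {1..n}"
  shows "rise p n"
  using permutes_atLeastAtMost_simps(2)[OF assms, of "Suc n"]
    permutes_atLeastAtMost_simps(5)[OF assms, of n] by (simp add: rise_def)

lemma signed_minus: "signed p S (- i) = - signed p S i"
  by (simp add: signed_def sgn_minus)

lemma abs_signed:
  assumes "p permutes {1..n}"
  shows "\<bar>signed p S i\<bar> = int (p (nat \<bar>i\<bar>))"
  using permutes_atLeastAtMost_simps(1)[OF assms]
  by (cases "i = 0") (auto simp: signed_def abs_mult sgn_if)

lemma pm_iff: "i \<in> pm n \<longleftrightarrow> nat \<bar>i\<bar> \<in> {1..n}"
  unfolding pm_def by auto

text \<open>The absolute value of an image determines that of its argument, and oddness separates
  \<open>i\<close> from \<open>- i\<close>. An injective self-map of the finite set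
  \<open>pm n\<close> is a bijection.\<close>

lemma signed_in_signed_perms:
  assumes p: "p permutes {1..n}" and S: "S \<subseteq> {1..n}"
  shows "signed p S \<in> signed_perms n"
proof -
  have inj: "inj (signed p S)"
  proof (rule injI)
    fix i j assume eq: "signed p S i = signed p S j"
    then have "int (p (nat \<bar>i\<bar>)) = int (p (nat \<bar>j\<bar>))"
      using abs_signed[OF p, of S i] abs_signed[OF p, of S j] by argo
    then have "nat \<bar>i\<bar> = nat \<bar>j\<bar>"
      using permutes_atLeastAtMost_simps(4)[OF p] by simp
    then consider "i = j" | "i = - j" by linarith
    then show "i = j"
    proof cases
      case 2
      then have "signed p S j = 0" using eq signed_minus[of p S j] by simp
      then have "p (nat \<bar>j\<bar>) = 0" using abs_signed[OF p, of S j] by simp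
      then have "j = 0" using permutes_atLeastAtMost_simps(3)[OF p] by simp
      then show ?thesis using 2 by simp
    qed
  qed
  have "signed p S ` pm n \<subseteq> pm n"
  proof
    fix k assume "k \<in> signed p S ` pm n"
    then obtain i where "i \<in> pm n" "k = signed p S i" by blast
    then show "k \<in> pm n"
      using permutes_in_image[OF p, of "nat \<bar>i\<bar>"] abs_signed[OF p, of S i]
      unfolding pm_iff by (metis nat_int)
  qed
  moreover have "finite (pm n)" by (simp add: pm_def)
  ultimately have bij: "bij_betw (signed p S) (pm n) (pm n)"
    using inj by (metis bij_betw_def endo_inj_surj inj_on_subset subset_UNIV)
  have "signed p S i = i" if "i \<notin> pm n" for i
  proof -
    have "nat \<bar>i\<bar> \<notin> S" "p (nat \<bar>i\<bar>) = nat \<bar>i\<bar>"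
      using that S permutes_not_in[OF p] unfolding pm_iff by auto
    then show ?thesis using sgn_mult_abs[of i] by (simp only: signed_def) simp
  qed
  with bij show ?thesis
    by (simp add: signed_perms_def signed_minus bij_imp_permutes)
qed

lemma signed_perms_odd:
  assumes "p \<in> signed_perms n"
  shows "p (- i) = - p i"
proof (cases "i \<in> pm n")
  case False
  then have "- i \<notin> pm n" by (simp add: pm_iff)
  with False show ?thesis
    using assms permutes_not_in[of p "pm n"] by (simp add: signed_perms_def)
qed (use assms in \<open>auto simp: signed_perms_def\<close>)

text \<open>By oddness, equal absolute values at \<open>i\<close> and \<open>j\<close> force
  \<open>i = j\<close> or \<open>i = - j\<close>, and the latter is impossible for positive
  positions.\<close>

lemma underlying_perm:
  assumes p: "p \<in> signed_perms n"
  shows "(\<lambda>j. nat \<bar>p (int j)\<bar>) permutes {1..n}" (is "?q permutes _")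
proof -
  have perm: "p permutes pm n" using p by (simp add: signed_perms_def)
  have "inj_on ?q {1..n}"
  proof (rule inj_onI)
    fix i j assume "?q i = ?q j" "i \<in> {1..n}" "j \<in> {1..n}"
    then consider "p (int i) = p (int j)" | "p (int i) = p (- int j)"
      using signed_perms_odd[OF p, of "int j"] by linarith
    then show "i = j"
      by cases (auto simp: inj_eq[OF permutes_inj[OF perm]])
  qed
  moreover have "?q ` {1..n} \<subseteq> {1..n}"
  proof
    fix k assume "k \<in> ?q ` {1..n}"
    then obtain j where j: "j \<in> {1..n}" "k = ?q j" by blast
    then have "int j \<in> pm n" by (simp add: pm_iff)
    then have "p (int j) \<in> pm n" using permutes_in_image[OF perm] by blast
    then show "k \<in> {1..n}" using j by (simp add: pm_iff)
  qed
  ultimately have "bij_betw ?q {1..n} {1..n}"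
    by (metis bij_betw_def endo_inj_surj finite_atLeastAtMost)
  moreover have "?q j = j" if "j \<notin> {1..n}" for j
    using that permutes_not_in[OF perm, of "int j"] by (simp add: pm_iff)
  ultimately show ?thesis by (rule bij_imp_permutes)
qed

text \<open>Both sides are odd, so comparing them at positive arguments suffices.\<close>

lemma signed_underlying:
  assumes p: "p \<in> signed_perms n"
  shows "signed (\<lambda>j. nat \<bar>p (int j)\<bar>) {j \<in> {1..n}. p (int j) < 0} = p" (is "?s = p")
proof
  have perm: "p permutes pm n" using p by (simp add: signed_perms_def)
  have s_pos: "?s (int j) = p (int j)" if "j > 0" for j
  proof -
    have "p (int j) = int j" if "j > n"
      using that permutes_not_in[OF perm, of "int j"] by (simp add: pm_iff)
    with that show ?thesis
      by (cases "j \<in> {1..n}") (auto simp: signed_def sgn_if)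
  qed
  have "p 0 = 0" using permutes_not_in[OF perm, of 0] by (simp add: pm_iff)
  fix i
  show "?s i = p i"
  proof (cases i rule: int_cases3)
    case zero
    then show ?thesis using \<open>p 0 = 0\<close> by (simp add: signed_def)
  next
    case (pos j)
    then show ?thesis using s_pos by simp
  next
    case (neg j)
    then show ?thesis
      using s_pos[of j] signed_perms_odd[OF p, of "int j"] by (simp add: signed_minus)
  qed
qed

lemma b_poly_signed:
  fixes x y :: "'a::comm_ring_1"
  shows "b_poly n x y = (\<Sum>p | p permutes {1..n}. \<Sum>S\<in>Pow {1..n}.
    x ^ desA n (signed p S) * y ^ desB n (signed p S))"
proof -
  have "b_poly n x y = (\<Sum>(p, S)\<in>{p. p permutes {1..n}} \<times> Pow {1..n}.
    x ^ desA n (signed p S) * y ^ desB n (signed p S))"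
    unfolding b_poly_def
  proof (rule sum.reindex_bij_witness[symmetric,
      where i = "\<lambda>p. (\<lambda>j. nat \<bar>p (int j)\<bar>, {j \<in> {1..n}. p (int j) < 0})"
        and j = "\<lambda>(p, S). signed p S"])
    fix a assume "a \<in> {p. p permutes {1..n}} \<times> Pow {1..n}"
    then obtain p S where a: "a = (p, S)" "p permutes {1..n}" "S \<subseteq> {1..n}" by auto
    then show "(case a of (p, S) \<Rightarrow> signed p S) \<in> signed_perms n"
      by (simp add: signed_in_signed_perms)
    \<comment> \<open>The signs can be read off because \<open>p j\<close> is nonzero for
      \<open>j\<close> in \<open>{1..n}\<close>.\<close>
    have "{j \<in> {1..n}. signed p S (int j) < 0} = S"
      using a permutes_atLeastAtMost_simps(3)[OF a(2)]
      by (auto simp: signed_def sgn_if neq0_conv[symmetric] simp del: neq0_conv split: if_splits)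
    then show "(\<lambda>j. nat \<bar>(case a of (p, S) \<Rightarrow> signed p S) (int j)\<bar>,
        {j \<in> {1..n}. (case a of (p, S) \<Rightarrow> signed p S) (int j) < 0}) = a"
      using a abs_signed[OF a(2)] by simp
  qed (auto simp: underlying_perm signed_underlying simp del: One_nat_def atLeastAtMost_iff)
  also have "\<dots> = (\<Sum>p | p permutes {1..n}. \<Sum>S\<in>Pow {1..n}.
    x ^ desA n (signed p S) * y ^ desB n (signed p S))"
    by (simp add: sum.cartesian_product)
  finally show ?thesis .
qed

section \<open>Descents and the sum over signs\<close>

text \<open>Of two neighbours, the one with the larger absolute value decides the comparison by its
  sign. This includes \<open>i = 0\<close>, where \<open>p\<close> rises.\<close>

lemma signed_descent_iff:
  assumes p: "p permutes {1..n}"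
  shows "signed p S (int i) > signed p S (int i + 1) \<longleftrightarrow>
    (if rise p i then Suc i \<in> S else i \<notin> S)"
proof -
  have *: "signed p S (int j) = (if j \<in> S then - int (p j) else int (p j))" for j
    using permutes_atLeastAtMost_simps(1)[OF p] by (auto simp: signed_def sgn_if)
  have "p i \<noteq> p (Suc i)" "p (Suc i) \<noteq> 0"
    using permutes_atLeastAtMost_simps(3,4)[OF p] by auto
  then show ?thesis
    using *[of i] *[of "Suc i"] by (auto simp: rise_def add.commute)
qed

lemma card_Collect_int:
  "card {i \<in> {int a..int n - 1}. P i} = card {i \<in> {a..<n}. P (int i)}"
proof -
  have "{i \<in> {int a..int n - 1}. P i} = int ` {i \<in> {a..<n}. P (int i)}"
  proof -
    have "i \<in> int ` {i \<in> {a..<n}. P (int i)}" if "i \<in> {int a..int n - 1}" "P i" for i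
      using that by (intro image_eqI[of _ _ "nat i"]) auto
    then show ?thesis by auto
  qed
  then show ?thesis by (simp add: card_image)
qed

lemma power_card_Collect:
  assumes "finite A"
  shows "(x::'a::comm_monoid_mult) ^ card {i \<in> A. P i} = (\<Prod>i\<in>A. if P i then x else 1)"
  using assms by (simp add: prod.If_cases Int_def)

text \<open>The sign at position \<open>j\<close> decides the descent at \<open>j - 1\<close> if \<open>p\<close> rises there, and the
  descent at \<open>j\<close> if \<open>p\<close> falls there, and nothing else; so the product over descents can be
  regrouped by signs.\<close>

lemma sum_signs:
  fixes x y :: "'a::comm_ring_1"
  assumes p: "p permutes {1..n}" and n: "n \<ge> 1"
  shows "(\<Sum>S\<in>Pow {1..n}. x ^ desA n (signed p S) * y ^ desB n (signed p S)) =
    (if rise p 1 then 1 + y else y * (1 + x)) *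
    (\<Prod>j\<in>{1<..n}. (if rise p (j - 1) then x * y else 1) + (if rise p j then 1 else x * y))"
proof -
  \<comment> \<open>A descent at \<open>0\<close> counts only for \<open>desB\<close>; every other
    descent counts for both statistics.\<close>
  define w where "w i = (if i = 0 then y else x * y)" for i :: nat
  define g where "g j b = (if rise p (j - 1) \<and> b then w (j - 1) else 1) *
    (if \<not> rise p j \<and> \<not> b then w j else 1)" for j b
  note r0 = rise_0[OF p] and rn = rise_n[OF p]
  have "x ^ desA n (signed p S) * y ^ desB n (signed p S) = (\<Prod>j\<in>{1..n}. g j (j \<in> S))" for S
  proof -
    define d where "d i \<longleftrightarrow> (if rise p i then Suc i \<in> S else i \<notin> S)" for i
    have A: "x ^ desA n (signed p S) = (\<Prod>i\<in>{1..<n}. if d i then x else 1)"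
      using card_Collect_int[of 1 n "\<lambda>i. signed p S i > signed p S (i + 1)"]
      by (simp add: desA_def d_def signed_descent_iff[OF p] flip: power_card_Collect)
    have B: "y ^ desB n (signed p S) = (\<Prod>i\<in>{0..<n}. if d i then y else 1)"
      using card_Collect_int[of 0 n "\<lambda>i. signed p S i > signed p S (i + 1)"]
      by (simp add: desB_def d_def signed_descent_iff[OF p] flip: power_card_Collect)
    have 0: "{0..<n} = insert 0 {1..<n}" using n by auto
    have "x ^ desA n (signed p S) * y ^ desB n (signed p S) = (\<Prod>i\<in>{0..<n}. if d i then w i else 1)"
    proof -
      have "(\<Prod>i\<in>{1..<n}. if d i then w i else 1) =
          (\<Prod>i\<in>{1..<n}. if d i then x else 1) * (\<Prod>i\<in>{1..<n}. if d i then y else 1)"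
        unfolding prod.distrib[symmetric] by (rule prod.cong) (auto simp: w_def)
      then show ?thesis unfolding A B 0 by (simp add: w_def mult_ac)
    qed
    also have "\<dots> = (\<Prod>i\<in>{0..<n}. if rise p i \<and> Suc i \<in> S then w i else 1) *
        (\<Prod>i\<in>{0..<n}. if \<not> rise p i \<and> i \<notin> S then w i else 1)"
      unfolding d_def by (auto simp flip: prod.distrib intro!: prod.cong)
    also have "(\<Prod>i\<in>{0..<n}. if rise p i \<and> Suc i \<in> S then w i else 1) =
        (\<Prod>j\<in>{1..n}. if rise p (j - 1) \<and> j \<in> S then w (j - 1) else 1)"
      by (rule prod.reindex_bij_witness[of _ "\<lambda>j. j - 1" Suc]) auto
    also have "(\<Prod>i\<in>{0..<n}. if \<not> rise p i \<and> i \<notin> S then w i else 1) =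
        (\<Prod>j\<in>{1..n}. if \<not> rise p j \<and> j \<notin> S then w j else 1)"
    proof -
      let ?h = "\<lambda>j. if \<not> rise p j \<and> j \<notin> S then w j else 1"
      \<comment> \<open>The index range can be shifted because \<open>p\<close> rises at
        \<open>0\<close> and at \<open>n\<close>, so both end factors are \<open>1\<close>.\<close>
      have "{0..n} = insert n {0..<n}" "{0..n} = insert 0 {1..n}" by auto
      then have "prod ?h (insert n {0..<n}) = prod ?h (insert 0 {1..n})" by simp
      then show ?thesis using r0 rn by simp
    qed
    finally show ?thesis by (simp add: g_def prod.distrib)
  qed
  then have "(\<Sum>S\<in>Pow {1..n}. x ^ desA n (signed p S) * y ^ desB n (signed p S)) =
      (\<Prod>j\<in>{1..n}. g j True + g j False)"
    by (simp add: sum_Pow_prod)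
  also have "(\<Prod>j\<in>{1..n}. g j True + g j False) =
      (g 1 True + g 1 False) * (\<Prod>j\<in>{1<..n}. g j True + g j False)"
  proof -
    have "{1..n} = insert 1 {1<..n}" using n by auto
    then show ?thesis by simp
  qed
  \<comment> \<open>A minus sign at position \<open>1\<close> contributes \<open>y\<close>, as
    \<open>p\<close> rises at \<open>0\<close>; a plus sign contributes \<open>1\<close> or
    \<open>x * y\<close>.\<close>
  also have "g 1 True + g 1 False = (if rise p 1 then 1 + y else y * (1 + x))"
    using r0 by (simp add: g_def w_def algebra_simps)
  also have "(\<Prod>j\<in>{1<..n}. g j True + g j False) =
      (\<Prod>j\<in>{1<..n}. (if rise p (j - 1) then x * y else 1) + (if rise p j then 1 else x * y))"
    by (rule prod.cong) (auto simp: g_def w_def)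
  finally show ?thesis .
qed

text \<open>The contribution of a permutation with \<open>udrun = r\<close> to the right-hand side of the theorem.\<close>

definition weight :: "nat \<Rightarrow> 'a::comm_ring_1 \<Rightarrow> 'a \<Rightarrow> nat \<Rightarrow> 'a" where
  "weight n x y r = (let k = (r - 1) div 2 in
    if odd r then (1 + y) * (4 ^ k * (x * y) ^ k * (1 + x * y) ^ (n - 1 - 2 * k))
    else y * (1 + x) * (2 * 4 ^ k * (x * y) ^ k * (1 + x * y) ^ (n - 2 - 2 * k)))"

text \<open>With \<open>k\<close> peaks beyond position \<open>1\<close>, the argument of
  \<open>weight\<close> is \<open>2 * k + 1\<close> if \<open>p\<close> rises at \<open>1\<close>
  and \<open>2 * k + 2\<close> otherwise, so \<open>weight\<close> recovers \<open>k\<close> in both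
  cases.\<close>

lemma sum_signs_eq_weight:
  fixes x y :: "'a::comm_ring_1"
  assumes p: "p permutes {1..n}" and n: "n \<ge> 1"
  shows "(\<Sum>S\<in>Pow {1..n}. x ^ desA n (signed p S) * y ^ desB n (signed p S)) =
    weight n x y (card (turns n p) + of_bool (rise p 1))"
proof -
  let ?A = "{1<..n}"
  define P where "P = {j \<in> ?A. rise p (j - 1) \<and> \<not> rise p j}"
  define V where "V = {j \<in> ?A. \<not> rise p (j - 1) \<and> rise p j}"
  define k where "k = card P"
  note r0 = rise_0[OF p] and rn = rise_n[OF p]
  \<comment> \<open>The balance is taken from \<open>1\<close> to \<open>n\<close>; since
    \<open>p\<close> ends with a rise, an initial fall costs one extra valley.\<close>
  have V: "card V = k + of_bool (\<not> rise p 1)"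
    using peaks_valleys_balance[OF n, of "rise p"] rn
    by (cases "rise p 1") (simp_all add: P_def V_def k_def)
  \<comment> \<open>As \<open>p\<close> rises at \<open>0\<close>, position \<open>1\<close> is a
    turn exactly when it is a peak, and \<open>P\<close> leaves it out.\<close>
  have "turns n p = (P \<union> V) \<union> (if rise p 1 then {} else {1})"
  proof -
    have "{1..n} = insert 1 ?A" using n by auto
    then show ?thesis using r0 by (auto simp: turns_def P_def V_def)
  qed
  moreover have "card (P \<union> V) = card P + card V"
    by (rule card_Un_disjoint) (auto simp: P_def V_def)
  moreover have "finite P" "finite V" "1 \<notin> P" "1 \<notin> V" by (auto simp: P_def V_def)
  ultimately have "card (turns n p) = card P + card V + of_bool (\<not> rise p 1)"
    by simp
  then have turns: "card (turns n p) = 2 * k + 2 * of_bool (\<not> rise p 1)"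
    unfolding V by (simp add: k_def)
  have "(\<Prod>j\<in>?A. (if rise p (j - 1) then x * y else 1) + (if rise p j then 1 else x * y)) =
      (2 * (x * y)) ^ k * 2 ^ card V * (1 + x * y) ^ (card ?A - k - card V)"
  proof -
    define f where "f a b = (if a then x * y else 1) + (if b then 1 else x * y)" for a b
    have f: "f True True = 1 + x * y" "f False False = 1 + x * y"
      "f True False = 2 * (x * y)" "f False True = 2"
      by (simp_all add: f_def)
    show ?thesis
      using prod_turns[of ?A f "1 + x * y" "rise p"] f
      unfolding P_def[symmetric] V_def[symmetric] k_def[symmetric] by (simp add: f_def[symmetric])
  qed
  also have "\<dots> = (4 ^ k * 2 ^ of_bool (\<not> rise p 1)) * (x * y) ^ k
      * (1 + x * y) ^ (n - 1 - 2 * k - of_bool (\<not> rise p 1))"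
  proof -
    have 4: "(4::'a) ^ k = 2 ^ k * 2 ^ k" using power_mult_distrib[of "2::'a" 2 k] by simp
    have e: "card ?A - k - (k + m) = n - 1 - 2 * k - m" for m by simp
    show ?thesis unfolding V e 4 power_mult_distrib power_add by (simp only: mult_ac)
  qed
  finally have prod: "(\<Prod>j\<in>?A. (if rise p (j - 1) then x * y else 1) + (if rise p j then 1 else x * y)) =
      (4 ^ k * 2 ^ of_bool (\<not> rise p 1)) * (x * y) ^ k
      * (1 + x * y) ^ (n - 1 - 2 * k - of_bool (\<not> rise p 1))" .
  show ?thesis
  proof (cases "rise p 1")
    case True
    then show ?thesis
      unfolding sum_signs[OF p n] turns prod by (simp add: weight_def mult.assoc)
  next
    case False
    have "n - 1 - 2 * k - 1 = n - 2 - 2 * k" by simp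
    with False show ?thesis
      unfolding sum_signs[OF p n] turns prod by (simp add: weight_def mult_ac)
  qed
qed

section \<open>Reversal and complementation\<close>

definition rev_compl :: "nat \<Rightarrow> (nat \<Rightarrow> nat) \<Rightarrow> nat \<Rightarrow> nat" where
  "rev_compl n p i = (if i \<in> {1..n} then Suc n - p (Suc n - i) else i)"

text \<open>The formula extends to \<open>0\<close> and \<open>Suc n\<close> because
  \<open>p\<close> fixes both, so the ends of the word need no separate treatment later.\<close>

lemma rev_compl_eq:
  assumes p: "p permutes {1..n}" and "i \<le> Suc n"
  shows "rev_compl n p i = Suc n - p (Suc n - i)"
  using permutes_atLeastAtMost_simps(1)[OF p] permutes_atLeastAtMost_simps(2)[OF p, of "Suc n"]
    assms(2) by (auto simp: rev_compl_def not_le le_Suc_eq)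

lemma rev_compl_permutes:
  assumes p: "p permutes {1..n}"
  shows "rev_compl n p permutes {1..n}"
proof -
  have in_range: "p (Suc n - i) \<in> {1..n}" if "i \<in> {1..n}" for i
    using permutes_in_image[OF p, of "Suc n - i"] that by auto
  have "inj_on (rev_compl n p) {1..n}"
  proof (rule inj_onI)
    fix i j assume ij: "i \<in> {1..n}" "j \<in> {1..n}" "rev_compl n p i = rev_compl n p j"
    then have "p (Suc n - i) = p (Suc n - j)"
      using diff_diff_cancel[of "p (Suc n - i)" "Suc n"] diff_diff_cancel[of "p (Suc n - j)" "Suc n"]
        in_range[of i] in_range[of j] by (simp add: rev_compl_def)
    then show "i = j" using permutes_atLeastAtMost_simps(4)[OF p] ij by auto
  qed
  moreover have "rev_compl n p ` {1..n} \<subseteq> {1..n}"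
    using in_range by (fastforce simp: rev_compl_def)
  ultimately have "bij_betw (rev_compl n p) {1..n} {1..n}"
    by (metis bij_betw_def endo_inj_surj finite_atLeastAtMost)
  then show ?thesis by (rule bij_imp_permutes) (auto simp: rev_compl_def)
qed

lemma rev_compl_rev_compl:
  assumes p: "p permutes {1..n}"
  shows "rev_compl n (rev_compl n p) = p"
proof
  fix i
  show "rev_compl n (rev_compl n p) i = p i"
  proof (cases "i \<in> {1..n}")
    case True
    then have "p i \<le> n" using permutes_atLeastAtMost_simps(5)[OF p] by simp
    with True show ?thesis by (auto simp: rev_compl_def)
  next
    case False
    then show ?thesis using permutes_not_in[OF p False] by (simp only: rev_compl_def if_False)
  qed
qed

text \<open>Reversal and complementation each invert the comparison of neighbours, so together they
  preserve it.\<close>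

lemma rise_rev_compl:
  assumes p: "p permutes {1..n}" and i: "i \<le> n"
  shows "rise (rev_compl n p) i = rise p (n - i)"
proof -
  \<comment> \<open>These bounds keep the natural subtraction \<open>Suc n - p j\<close> from
    truncating, so it reverses the order strictly.\<close>
  have le: "p j \<le> Suc n" if "j \<le> Suc n" for j
    using permutes_atLeastAtMost_simps(2,5)[OF p, of j] that by (cases "j = Suc n") auto
  have "rev_compl n p i = Suc n - p (Suc (n - i))" "rev_compl n p (Suc i) = Suc n - p (n - i)"
    using rev_compl_eq[OF p, of i] rev_compl_eq[OF p, of "Suc i"] i by (simp_all add: Suc_diff_le)
  moreover have "p (Suc (n - i)) \<le> Suc n" "p (n - i) \<le> Suc n" by (simp_all add: le)
  ultimately show ?thesis by (simp only: rise_def) linarith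
qed

text \<open>The reflection of \<open>i\<close> to \<open>Suc n - i\<close> matches the turns of the
  two words.\<close>

lemma card_turns_rev_compl:
  assumes p: "p permutes {1..n}"
  shows "card (turns n (rev_compl n p)) = card (turns n p)"
proof -
  have *: "i \<in> turns n (rev_compl n p) \<longleftrightarrow> Suc n - i \<in> turns n p" if "i \<in> {1..n}" for i
  proof -
    have "Suc n - i - 1 = n - i" "n - (i - 1) = Suc n - i" "i \<le> n" "i - 1 \<le> n"
      "Suc n - i \<in> {1..n}" using that by auto
    then show ?thesis
      using that rise_rev_compl[OF p, of i] rise_rev_compl[OF p, of "i - 1"]
      unfolding turns_def mem_Collect_eq by metis
  qed
  have sub: "turns n q \<subseteq> {1..n}" for q by (auto simp: turns_def)
  have "bij_betw (\<lambda>i. Suc n - i) (turns n (rev_compl n p)) (turns n p)"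
  proof (rule bij_betw_byWitness[where f' = "\<lambda>i. Suc n - i"])
    show "(\<lambda>i. Suc n - i) ` turns n (rev_compl n p) \<subseteq> turns n p"
      using * sub by blast
    show "(\<lambda>i. Suc n - i) ` turns n p \<subseteq> turns n (rev_compl n p)"
    proof clarify
      fix i assume i: "i \<in> turns n p"
      then have "i \<in> {1..n}" using sub by blast
      then show "Suc n - i \<in> turns n (rev_compl n p)"
        using i *[of "Suc n - i"] by (auto simp: Suc_diff_le)
    qed
  qed (use sub in fastforce)+
  then show ?thesis by (rule bij_betw_same_card)
qed

section \<open>Up-down runs and the final summation\<close>

text \<open>Runs start at \<open>0\<close> and at the turns before \<open>n\<close>. Position
  \<open>n\<close> is a turn exactly if \<open>p\<close> falls at \<open>n - 1\<close>, and then it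
  makes up in the count for the start at \<open>0\<close>.\<close>

lemma udrun_eq_card_turns:
  assumes p: "p permutes {1..n}" and n: "n \<ge> 1"
  shows "udrun n p = card (turns n p) + of_bool (rise p (n - 1))"
proof -
  let ?A = "{a. 0 < a \<and> a < n \<and> (p (a - 1) < p a) \<noteq> (p a < p (a + 1))}"
  note rn = rise_n[OF p]
  have "turns n p = ?A \<union> (if rise p (n - 1) then {} else {n})"
  proof -
    have "{1..n} = insert n {a. 0 < a \<and> a < n}" using n by auto
    then show ?thesis using rn by (auto simp: turns_def rise_def)
  qed
  then show ?thesis
    unfolding udrun_def card_runs[OF inj_on_perm[OF p]] by simp
qed

text \<open>Group the permutations by \<open>udrun\<close> and separate odd from even values. The
  generous bound \<open>2 * n\<close> lets both parities run over \<open>k < n\<close>.\<close>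

lemma sum_permutes_udrun:
  fixes G :: "nat \<Rightarrow> 'a::comm_semiring_1"
  assumes n: "n \<ge> 1"
  shows "(\<Sum>p | p permutes {1..n}. G (udrun n p)) =
    (\<Sum>k<n. of_nat (T n (2 * k + 1)) * G (2 * k + 1)) +
    (\<Sum>k<n. of_nat (T n (2 * k + 2)) * G (2 * k + 2))"
proof -
  let ?S = "{p. p permutes {1..n}}" and ?K = "{1..2 * n}"
  have fin: "finite ?S" by (rule finite_permutations) simp
  have "udrun n p \<in> ?K" if p: "p permutes {1..n}" for p
  proof -
    have "card {i \<in> {1..n - 1}. (int (p i) - int (p (i - 1))) * (int (p (i + 1)) - int (p i)) < 0}
      \<le> card {1..n - 1}" by (rule card_mono) auto
    then show ?thesis using udrun_eq[OF p] n by simp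
  qed
  then have "(\<Sum>p\<in>?S. G (udrun n p)) = (\<Sum>r\<in>?K. \<Sum>p | p \<in> ?S \<and> udrun n p = r. G (udrun n p))"
    using fin by (intro sum.group[symmetric]) auto
  also have "\<dots> = (\<Sum>r\<in>?K. of_nat (T n r) * G r)"
    by (simp add: T_def)
  also have "\<dots> = (\<Sum>k<n. of_nat (T n (2 * k + 1)) * G (2 * k + 1)) +
    (\<Sum>k<n. of_nat (T n (2 * k + 2)) * G (2 * k + 2))"
  proof -
    have "(\<Sum>r\<in>{1..2 * m}. f r) = (\<Sum>k<m. f (2 * k + 1)) + (\<Sum>k<m. f (2 * k + 2))"
      for f :: "nat \<Rightarrow> 'a" and m by (induction m) (simp_all add: add_ac)
    then show ?thesis .
  qed
  finally show ?thesis .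
qed

theorem theorem1:
  fixes x y :: "'a::comm_ring_1" and n :: nat
  assumes "n \<ge> 2"
  shows "b_poly n x y =
      (1 + y) * Sum_any (\<lambda>k::nat. 4 ^ k * of_nat (xi n k) * (x * y) ^ k * (1 + x * y) ^ (n - 1 - 2 * k))
    + y * (1 + x) * Sum_any (\<lambda>k::nat. 4 ^ k * of_nat (zeta n k) * (x * y) ^ k * (1 + x * y) ^ (n - 2 - 2 * k))"
proof -
  have n: "n \<ge> 1" using assms by simp
  \<comment> \<open>By \<open>T_eq_0\<close> the summands with \<open>k \<ge> n\<close> vanish, so
    both infinite sums become finite ones.\<close>
  have any: "Sum_any f = (\<Sum>k<n. f k)" if "\<And>k. k \<ge> n \<Longrightarrow> f k = 0" for f :: "nat \<Rightarrow> 'a"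
    using that by (intro Sum_any.expand_superset) (auto simp: not_less[symmetric])
  have "b_poly n x y =
      (\<Sum>p | p permutes {1..n}. weight n x y (card (turns n p) + of_bool (rise p 1)))"
    unfolding b_poly_signed 
    using n by (intro sum.cong refl sum_signs_eq_weight) simp_all
  \<comment> \<open>The involution \<open>rev_compl n\<close> keeps the number of turns and carries
    \<open>rise p 1\<close> to \<open>rise p (n - 1)\<close>, which turns the argument of
    \<open>weight\<close> into \<open>udrun\<close>.\<close>
  also have "\<dots> = (\<Sum>p | p permutes {1..n}. weight n x y (udrun n p))"
    by (rule sum.reindex_bij_witness[of _ "rev_compl n" "rev_compl n"])
      (use assms in \<open>auto simp: rev_compl_rev_compl rev_compl_permutes udrun_eq_card_turns
        card_turns_rev_compl rise_rev_compl simp del: One_nat_def\<close>)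
  also have "\<dots> = (\<Sum>k<n. of_nat (T n (2 * k + 1)) * weight n x y (2 * k + 1)) +
      (\<Sum>k<n. of_nat (T n (2 * k + 2)) * weight n x y (2 * k + 2))"
    by (rule sum_permutes_udrun[OF n])
  also have "(\<Sum>k<n. of_nat (T n (2 * k + 1)) * weight n x y (2 * k + 1)) =
      (1 + y) * (\<Sum>k<n. 4 ^ k * of_nat (xi n k) * (x * y) ^ k * (1 + x * y) ^ (n - 1 - 2 * k))"
    by (simp add: weight_def xi_def sum_distrib_left mult_ac)
  also have "(\<Sum>k<n. of_nat (T n (2 * k + 2)) * weight n x y (2 * k + 2)) =
      y * (1 + x) * (\<Sum>k<n. 4 ^ k * of_nat (zeta n k) * (x * y) ^ k * (1 + x * y) ^ (n - 2 - 2 * k))"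
    by (simp add: weight_def zeta_def sum_distrib_left mult_ac)
  finally show ?thesis
    using n by (simp add: any xi_def zeta_def T_eq_0)
qed

end
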